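(* Let $M$ be a matroid of rank $r$ on a finite set $E$ and let $P_M$ be its matroid polytope. Then, as a signed Minkowski sum, \[P_M=\sum_{A\subseteq E}\widetilde{\beta}(M/A)\,\Delta_{E-A},\] i.e. $P_M+\sum_{A:\,\widetilde\beta(M/A)<0}(-\widetilde\beta(M/A))\Delta_{E-A}=\sum_{A:\,\widetilde\beta(M/A)>0}\widetilde\beta(M/A)\Delta_{E-A}$ (terms with coefficient $0$ omitted; the term $A=E$ always has coefficient $0$).
   Context: The matroid polytope $P_M\subseteq\mathbb{R}^E$ is the convex hull of the indicator vectors $\sum_{i\in B}e_i$ of the bases $B$ of $M$. For nonempty $J\subseteq E$, $\Delta_J=\mathrm{conv}\{e_i:i\in J\}$. For $A\subseteq E$, $M/A$ is the contraction, a matroid on $E-A$ with rank function $r_{M/A}(X)=r(X\cup A)-r(A)$. The beta invariant of a matroid $N$ on ground set $S$ with rank function $r_N$ is $\beta(N)=(-1)^{r_N(S)}\sum_{X\subseteq S}(-1)^{|X|}r_N(X)$, and the signed beta invariant is $\widetilde\beta(N)=(-1)^{r_N(S)+1}\beta(N)$. Minkowski sum: $P+Q=\{p+q\}$, $yQ=\{yq\}$ for $y\ge 0$. *)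

theory Defs
  imports "HOL-Analysis.Analysis" "HOL-Library.Set_Algebras"
begin

text \<open>A matroid is given by its finite ground set and its rank function. The axioms constrain
  \<open>r\<close> on subsets of \<open>E\<close> only.\<close>

locale matroid =
  fixes E :: "'a set" and r :: "'a set \<Rightarrow> nat"
  assumes finite_ground: "finite E"
    and rank_le_card: "X \<subseteq> E \<Longrightarrow> r X \<le> card X"
    and rank_mono: "X \<subseteq> Y \<Longrightarrow> Y \<subseteq> E \<Longrightarrow> r X \<le> r Y"
    and rank_submodular: "X \<subseteq> E \<Longrightarrow> Y \<subseteq> E \<Longrightarrow> r (X \<union> Y) + r (X \<inter> Y) \<le> r X + r Y"

definition indep :: "'a set \<Rightarrow> ('a set \<Rightarrow> nat) \<Rightarrow> 'a set \<Rightarrow> bool" where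
  "indep E r I \<longleftrightarrow> I \<subseteq> E \<and> r I = card I"

definition basis :: "'a set \<Rightarrow> ('a set \<Rightarrow> nat) \<Rightarrow> 'a set \<Rightarrow> bool" where
  "basis E r B \<longleftrightarrow> indep E r B \<and> (\<forall>I. indep E r I \<and> B \<subseteq> I \<longrightarrow> I = B)"

text \<open>Rank function of the contraction by \<open>A\<close>, whose ground set is \<open>E - A\<close>. For \<open>A \<subseteq> E\<close> and
  \<open>X \<subseteq> E - A\<close> the subtraction does not truncate, by monotonicity of the rank.\<close>

definition contract :: "('a set \<Rightarrow> nat) \<Rightarrow> 'a set \<Rightarrow> 'a set \<Rightarrow> nat" where
  "contract r A X = r (X \<union> A) - r A"

definition beta :: "'a set \<Rightarrow> ('a set \<Rightarrow> nat) \<Rightarrow> int" where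
  "beta S r = (-1) ^ r S * (\<Sum>X\<in>Pow S. (-1) ^ card X * int (r X))"

definition signed_beta :: "'a set \<Rightarrow> ('a set \<Rightarrow> nat) \<Rightarrow> int" where
  "signed_beta S r = (-1) ^ (r S + 1) * beta S r"

text \<open>For \<open>E :: 'e set\<close>, the space of real vectors indexed by \<open>E\<close> is the coordinate subspace of
  \<open>real ^ 'e\<close> of vectors vanishing outside \<open>E\<close>.\<close>

definition matroid_polytope :: "'e::finite set \<Rightarrow> ('e set \<Rightarrow> nat) \<Rightarrow> (real ^ 'e) set" where
  "matroid_polytope E r = convex hull {\<Sum>i\<in>B. axis i 1 | B. basis E r B}"

definition coord_simplex :: "'e::finite set \<Rightarrow> (real ^ 'e) set" where
  "coord_simplex J = convex hull {axis i 1 | i. i \<in> J}"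

text \<open>Consistency with the independent-set axioms, and closure under contraction.\<close>

context matroid
begin

lemma indep_empty: "indep E r {}"
  using rank_le_card[of "{}"] by (simp add: indep_def)

lemma indep_subset:
  assumes "indep E r J" "I \<subseteq> J"
  shows "indep E r I"
proof -
  have J: "J \<subseteq> E" "r J = card J" and fin: "finite J"
    using assms finite_ground by (auto simp: indep_def intro: finite_subset)
  have "r (I \<union> (J - I)) + r (I \<inter> (J - I)) \<le> r I + r (J - I)"
    using J assms by (intro rank_submodular) auto
  moreover have "I \<union> (J - I) = J" using assms by auto
  moreover have "r (J - I) \<le> card (J - I)" "r I \<le> card I"
    using J assms by (auto intro!: rank_le_card)
  moreover have "card J = card I + card (J - I)"
    using fin assms(2) by (metis card_Diff_subset card_mono finite_subset le_add_diff_inverse)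
  ultimately show ?thesis using J assms by (auto simp: indep_def)
qed

lemma indep_augment:
  assumes "indep E r I" "indep E r J" "card I < card J"
  shows "\<exists>e\<in>J - I. indep E r (insert e I)"
proof (rule ccontr)
  assume neg: "\<not> ?thesis"
  have sub: "I \<subseteq> E" "J \<subseteq> E" and rI: "r I = card I" and rJ: "r J = card J"
    and fin: "finite I" "finite J"
    using assms finite_ground by (auto simp: indep_def intro: finite_subset)
  have step: "r (insert e I) \<le> card I" if "e \<in> J - I" for e
  proof -
    have "insert e I \<subseteq> E" using that sub by auto
    moreover have "r (insert e I) \<noteq> card (insert e I)"
      using neg that calculation by (auto simp: indep_def)
    moreover have "card (insert e I) = Suc (card I)" using that fin by simp
    ultimately show ?thesis using rank_le_card[of "insert e I"] by simp
  qed
  have "r (I \<union> K) \<le> card I" if "finite K" "K \<subseteq> J - I" for K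
    using that
  proof (induction K)
    case empty
    then show ?case using rI by simp
  next
    case (insert e K)
    have "r ((I \<union> K) \<union> insert e I) + r ((I \<union> K) \<inter> insert e I) \<le> r (I \<union> K) + r (insert e I)"
      using sub insert.prems by (intro rank_submodular) auto
    moreover have "(I \<union> K) \<union> insert e I = I \<union> insert e K" "(I \<union> K) \<inter> insert e I = I"
      using insert.hyps by auto
    ultimately show ?case using insert step[of e] rI by simp
  qed
  from this[of "J - I"] have "r (I \<union> J) \<le> card I" using fin by simp
  moreover have "r J \<le> r (I \<union> J)" using sub by (intro rank_mono) auto
  ultimately show False using rJ assms(3) by simp
qed

lemma matroid_contract:
  assumes "A \<subseteq> E"
  shows "matroid (E - A) (contract r A)"
proof
  show "finite (E - A)" using finite_ground by simp
next
  fix X assume X: "X \<subseteq> E - A"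
  have "r (X \<union> A) \<le> r X + r A"
    using rank_submodular[of X A] X assms by (simp add: subset_iff)
  moreover have "r X \<le> card X" using X by (intro rank_le_card) auto
  ultimately show "contract r A X \<le> card X" by (simp add: contract_def)
next
  fix X Y assume "X \<subseteq> Y" "Y \<subseteq> E - A"
  then have "r (X \<union> A) \<le> r (Y \<union> A)" using assms by (intro rank_mono) auto
  then show "contract r A X \<le> contract r A Y" by (simp add: contract_def diff_le_mono)
next
  fix X Y assume XY: "X \<subseteq> E - A" "Y \<subseteq> E - A"
  have "r ((X \<union> A) \<union> (Y \<union> A)) + r ((X \<union> A) \<inter> (Y \<union> A)) \<le> r (X \<union> A) + r (Y \<union> A)"
    using XY assms by (intro rank_submodular) auto
  moreover have "(X \<union> A) \<union> (Y \<union> A) = (X \<union> Y) \<union> A" "(X \<union> A) \<inter> (Y \<union> A) = (X \<inter> Y) \<union> A"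
    by auto
  moreover have "r A \<le> r (Z \<union> A)" if "Z \<subseteq> E" for Z
    using that assms by (intro rank_mono) auto
  then have "r A \<le> r (X \<union> A)" "r A \<le> r (Y \<union> A)" "r A \<le> r ((X \<inter> Y) \<union> A)" "r A \<le> r ((X \<union> Y) \<union> A)"
    using XY by blast+
  ultimately show "contract r A (X \<union> Y) + contract r A (X \<inter> Y) \<le> contract r A X + contract r A Y"
    by (simp add: contract_def)
qed

end

end

theory Submission
  imports Defs
begin

text \<open>Two compact convex sets coincide as soon as their support functions do, and support functions
  turn Minkowski sums into sums. Fix a weight \<open>w\<close> and list \<open>E\<close> as \<open>e\<^sub>0, \<dots>, e\<^sub>n\<^sub>-\<^sub>1\<close> by decreasing weight,
  with initial segments \<open>E\<^sub>k = {e\<^sub>0, \<dots>, e\<^sub>k\<^sub>-\<^sub>1}\<close>. The greedy algorithm gives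
  \<open>\<Sum>\<^sub>k w(e\<^sub>k) (r(E\<^sub>k\<^sub>+\<^sub>1) - r(E\<^sub>k))\<close> as the maximum of \<open>w\<close> on the matroid polytope. The simplex on \<open>E - A\<close>
  has maximum \<open>w(e\<^sub>k)\<close>, where \<open>e\<^sub>k\<close> is the first element outside \<open>A\<close>. Moebius inversion shows that
  the signed beta invariants of \<open>M/A\<close> over \<open>Z \<subseteq> A \<subseteq> E\<close> add up to \<open>r(E) - r(Z)\<close>, so the coefficient of
  \<open>w(e\<^sub>k)\<close> on the simplex side is \<open>r(E\<^sub>k\<^sub>+\<^sub>1) - r(E\<^sub>k)\<close> as well.\<close>

subsection \<open>Support values of Minkowski sums\<close>

text \<open>A relation rather than a supremum: it asserts that the maximum is attained, so no
  separate boundedness or nonemptiness conditions arise.\<close>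

definition support_value :: "'v::real_inner \<Rightarrow> 'v set \<Rightarrow> real \<Rightarrow> bool" where
  "support_value w S h \<longleftrightarrow> (\<forall>x\<in>S. w \<bullet> x \<le> h) \<and> (\<exists>x\<in>S. w \<bullet> x = h)"

lemma support_value_plus:
  assumes "support_value w S h" "support_value w T k"
  shows "support_value w (S + T) (h + k)"
proof -
  obtain x y where "x \<in> S" "w \<bullet> x = h" "y \<in> T" "w \<bullet> y = k"
    using assms by (auto simp: support_value_def)
  then have "x + y \<in> S + T" "w \<bullet> (x + y) = h + k" by (auto simp: inner_add_right)
  moreover have "w \<bullet> z \<le> h + k" if "z \<in> S + T" for z
    using that assms unfolding support_value_def
    by (elim set_plus_elim) (simp add: inner_add_right add_mono)
  ultimately show ?thesis unfolding support_value_def by blast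
qed

lemma support_value_sum:
  assumes "finite I" "\<And>i. i \<in> I \<Longrightarrow> support_value w (S i) (h i)"
  shows "support_value w (\<Sum>i\<in>I. S i) (\<Sum>i\<in>I. h i)"
  using assms
proof (induction I rule: finite_induct)
  case empty
  then show ?case by (simp add: support_value_def)
next
  case (insert i I)
  then show ?case by (simp add: support_value_plus)
qed

lemma support_value_scaleR:
  assumes "support_value w S h" "0 \<le> c"
  shows "support_value w ((*\<^sub>R) c ` S) (c * h)"
  using assms by (auto simp: support_value_def mult_left_mono)

text \<open>The half-space below height \<open>h\<close> is convex, so it contains the hull as soon
  as it contains \<open>S\<close>; the maximizer already lies in \<open>S\<close>.\<close>

lemma support_value_convex_hull:
  assumes "support_value w S h"
  shows "support_value w (convex hull S) h"
proof -
  have "convex hull S \<subseteq> {x. w \<bullet> x \<le> h}"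
    using assms by (intro hull_minimal) (auto simp: support_value_def convex_halfspace_le)
  then show ?thesis
    using assms hull_subset[of S convex] by (force simp: support_value_def)
qed

text \<open>A point of \<open>S\<close> outside \<open>T\<close> could be strictly separated from
  \<open>T\<close>, and in the separating direction the two maxima would differ.\<close>

lemma support_value_separates:
  fixes S T :: "'v::euclidean_space set"
  assumes "convex T" "closed T" "\<And>w. \<exists>h. support_value w S h \<and> support_value w T h"
  shows "S \<subseteq> T"
proof
  fix x assume x: "x \<in> S"
  show "x \<in> T"
  proof (rule ccontr)
    assume "x \<notin> T"
    then obtain a b where ab: "a \<bullet> x < b" "\<forall>y\<in>T. b < a \<bullet> y"
      using separating_hyperplane_closed_point assms by blast
    \<comment> \<open>\<open>T\<close> lies on the side where \<open>a\<close> is large, so the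
      direction in which \<open>x\<close> exceeds \<open>T\<close> is \<open>- a\<close>.\<close>
    obtain h where h: "support_value (- a) S h" "support_value (- a) T h"
      using assms(3) by blast
    then obtain y where "y \<in> T" "- a \<bullet> y = h" by (auto simp: support_value_def)
    moreover have "- a \<bullet> x \<le> h" using h(1) x by (auto simp: support_value_def)
    ultimately show False using ab by fastforce
  qed
qed

lemma eq_if_support_values_eq:
  fixes S T :: "'v::euclidean_space set"
  assumes "convex S" "closed S" "convex T" "closed T"
    and "\<And>w. \<exists>h. support_value w S h \<and> support_value w T h"
  shows "S = T"
  using support_value_separates[of T S] support_value_separates[of S T] assms by blast

lemma compact_set_plus:
  fixes S T :: "'v::real_normed_vector set"
  assumes "compact S" "compact T"
  shows "compact (S + T)"
proof -
  have "S + T = {x + y | x y. x \<in> S \<and> y \<in> T}" by (auto simp: set_plus_def)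
  then show ?thesis using compact_sums[OF assms] by simp
qed

lemma compact_convex_set_sum:
  fixes S :: "'i \<Rightarrow> 'v::real_normed_vector set"
  assumes "finite I" "\<And>i. i \<in> I \<Longrightarrow> compact (S i) \<and> convex (S i)"
  shows "compact (\<Sum>i\<in>I. S i) \<and> convex (\<Sum>i\<in>I. S i)"
  using assms
  by (induction I rule: finite_induct) (auto simp: compact_set_plus convex_set_plus)

subsection \<open>Moebius inversion for the signed beta invariant\<close>

text \<open>For nonempty \<open>S\<close>, fix \<open>a\<close> in \<open>S\<close>: the subsets
  \<open>X\<close> and \<open>insert a X\<close> with \<open>a\<close> not in \<open>X\<close> have
  opposite signs and cancel.\<close>

lemma sum_Pow_alternating:
  assumes "finite S"
  shows "(\<Sum>X\<in>Pow S. (- 1 :: int) ^ card X) = (if S = {} then 1 else 0)"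
proof (cases "S = {}")
  case False
  then obtain a T where S: "S = insert a T" "a \<notin> T" by (meson Set.set_insert ex_in_conv)
  have T: "finite T" using assms S by simp
  have fin: "finite X" if "X \<in> Pow T" for X using that T by (auto intro: finite_subset)
  have "(\<Sum>X\<in>insert a ` Pow T. (- 1 :: int) ^ card X) = (\<Sum>X\<in>Pow T. (- 1) ^ card (insert a X))"
    using S(2) by (subst sum.reindex) (auto intro!: inj_onI)
  also have "\<dots> = (\<Sum>X\<in>Pow T. - ((- 1) ^ card X))"
    using S(2) fin by (intro sum.cong refl) (subst card_insert_disjoint, auto)
  finally show ?thesis
    using S T by (subst S(1), subst Pow_insert, subst sum.union_disjoint) (auto simp: sum_negf)
qed simp

text \<open>With \<open>Y = X \<union> A\<close> and the sums exchanged, the coefficient of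
  \<open>f Y\<close> is an alternating sum over the interval from \<open>Z\<close> to
  \<open>Y\<close>, which vanishes unless \<open>Y = Z\<close>.\<close>

lemma moebius_upper_sets:
  fixes f :: "'a set \<Rightarrow> int"
  assumes "finite E" "Z \<subseteq> E"
  shows "(\<Sum>A | Z \<subseteq> A \<and> A \<subseteq> E. \<Sum>X\<in>Pow (E - A). (- 1) ^ card X * f (X \<union> A)) = f Z"
proof -
  have fin: "finite {A. Z \<subseteq> A \<and> A \<subseteq> E}" "finite {Y. A \<subseteq> Y \<and> Y \<subseteq> E}" for A
    using assms(1) by (auto intro: finite_subset[OF _ finite_Pow_iff[THEN iffD2]])
  have "(\<Sum>X\<in>Pow (E - A). (- 1) ^ card X * f (X \<union> A))
      = (\<Sum>Y | A \<subseteq> Y \<and> Y \<subseteq> E. (- 1) ^ card (Y - A) * f Y)" if "A \<subseteq> E" for A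
  proof (intro sum.reindex_bij_witness[of _ "\<lambda>Y. Y - A" "\<lambda>X. X \<union> A"])
    fix X assume "X \<in> Pow (E - A)"
    then show X: "X \<union> A - A = X" by auto
    show "(- 1) ^ card (X \<union> A - A) * f (X \<union> A) = (- 1) ^ card X * f (X \<union> A)"
      by (simp only: X)
  qed (use that in auto)
  then have "(\<Sum>A | Z \<subseteq> A \<and> A \<subseteq> E. \<Sum>X\<in>Pow (E - A). (- 1) ^ card X * f (X \<union> A))
      = (\<Sum>A | Z \<subseteq> A \<and> A \<subseteq> E. \<Sum>Y | A \<subseteq> Y \<and> Y \<subseteq> E. (- 1) ^ card (Y - A) * f Y)"
    by (intro sum.cong[OF refl]) auto
  also have "\<dots> = (\<Sum>Y | Z \<subseteq> Y \<and> Y \<subseteq> E. \<Sum>A | Z \<subseteq> A \<and> A \<subseteq> Y. (- 1) ^ card (Y - A) * f Y)"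
  proof -
    \<comment> \<open>Adding the implied condition \<open>Z \<subseteq> Y\<close> makes the inner
      range a restriction of a fixed set, the form in which the sums can be exchanged.\<close>
    have "(\<Sum>A | Z \<subseteq> A \<and> A \<subseteq> E. \<Sum>Y | A \<subseteq> Y \<and> Y \<subseteq> E. (- 1) ^ card (Y - A) * f Y)
      = (\<Sum>A | Z \<subseteq> A \<and> A \<subseteq> E. \<Sum>Y | Y \<in> {Y. Z \<subseteq> Y \<and> Y \<subseteq> E} \<and> A \<subseteq> Y. (- 1) ^ card (Y - A) * f Y)"
      by (intro sum.cong) auto
    also have "\<dots> = (\<Sum>Y | Z \<subseteq> Y \<and> Y \<subseteq> E. \<Sum>A | A \<in> {A. Z \<subseteq> A \<and> A \<subseteq> E} \<and> A \<subseteq> Y. (- 1) ^ card (Y - A) * f Y)"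
      using fin by (intro sum.swap_restrict) auto
    also have "\<dots> = (\<Sum>Y | Z \<subseteq> Y \<and> Y \<subseteq> E. \<Sum>A | Z \<subseteq> A \<and> A \<subseteq> Y. (- 1) ^ card (Y - A) * f Y)"
      by (intro sum.cong) auto
    finally show ?thesis .
  qed
  also have "\<dots> = (\<Sum>Y | Z \<subseteq> Y \<and> Y \<subseteq> E. if Y = Z then f Y else 0)"
  proof (intro sum.cong refl)
    fix Y assume "Y \<in> {Y. Z \<subseteq> Y \<and> Y \<subseteq> E}"
    then have Y: "Z \<subseteq> Y" "Y \<subseteq> E" by auto
    \<comment> \<open>Complementation in \<open>Y\<close> carries the interval from \<open>Z\<close>
      to \<open>Y\<close> onto the subsets of \<open>Y - Z\<close>.\<close>
    have "(\<Sum>A | Z \<subseteq> A \<and> A \<subseteq> Y. (- 1 :: int) ^ card (Y - A)) = (\<Sum>X\<in>Pow (Y - Z). (- 1) ^ card X)"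
      using Y by (intro sum.reindex_bij_witness[of _ "\<lambda>X. Y - X" "\<lambda>A. Y - A"]) auto
    also have "\<dots> = (if Y = Z then 1 else 0)"
      using Y assms(1) by (subst sum_Pow_alternating) (auto intro: finite_subset)
    finally show "(\<Sum>A | Z \<subseteq> A \<and> A \<subseteq> Y. (- 1) ^ card (Y - A) * f Y) = (if Y = Z then f Y else 0)"
      by (simp flip: sum_distrib_right)
  qed
  also have "\<dots> = f Z"
    using fin(1) assms(2) by (simp add: sum.delta)
  finally show ?thesis .
qed

text \<open>The two sign factors combine to an odd power of -1, so the parity of the rank
  disappears.\<close>

lemma signed_beta_eq: "signed_beta S r = - (\<Sum>X\<in>Pow S. (- 1) ^ card X * int (r X))"
  by (simp add: signed_beta_def beta_def flip: power_add mult.assoc)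

context matroid
begin

text \<open>The constant \<open>r A\<close> subtracted in the contraction is multiplied by the
  alternating sum over subsets of \<open>E - A\<close>, so it survives only for
  \<open>A = E\<close>.\<close>

lemma signed_beta_contract:
  assumes "A \<subseteq> E"
  shows "signed_beta (E - A) (contract r A)
    = (if A = E then int (r E) else 0) - (\<Sum>X\<in>Pow (E - A). (- 1) ^ card X * int (r (X \<union> A)))"
proof -
  have "int (contract r A X) = int (r (X \<union> A)) - int (r A)" if "X \<in> Pow (E - A)" for X
  proof -
    have "r A \<le> r (X \<union> A)" using that assms by (intro rank_mono) auto
    then show ?thesis by (simp add: contract_def of_nat_diff)
  qed
  then have "signed_beta (E - A) (contract r A)
      = - (\<Sum>X\<in>Pow (E - A). (- 1) ^ card X * int (r (X \<union> A)) - (- 1) ^ card X * int (r A))"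
    by (simp add: signed_beta_eq right_diff_distrib)
  also have "\<dots> = (\<Sum>X\<in>Pow (E - A). (- 1) ^ card X) * int (r A)
      - (\<Sum>X\<in>Pow (E - A). (- 1) ^ card X * int (r (X \<union> A)))"
    by (simp add: sum_subtractf sum_distrib_right)
  also have "(\<Sum>X\<in>Pow (E - A). (- 1 :: int) ^ card X) = (if A = E then 1 else 0)"
    using assms finite_ground by (subst sum_Pow_alternating) auto
  finally show ?thesis by simp
qed

lemma signed_beta_contract_ground: "signed_beta (E - E) (contract r E) = 0"
  using signed_beta_contract[of E] by simp

text \<open>The correction at \<open>A = E\<close> contributes \<open>r E\<close>; Moebius inversion
  of the remaining terms contributes \<open>- r Z\<close>.\<close>

lemma sum_signed_beta_contract:
  assumes "Z \<subseteq> E"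
  shows "(\<Sum>A | Z \<subseteq> A \<and> A \<subseteq> E. signed_beta (E - A) (contract r A)) = int (r E) - int (r Z)"
proof -
  have fin: "finite {A. Z \<subseteq> A \<and> A \<subseteq> E}"
    using finite_ground by (auto intro: finite_subset[OF _ finite_Pow_iff[THEN iffD2]])
  have "(\<Sum>A | Z \<subseteq> A \<and> A \<subseteq> E. signed_beta (E - A) (contract r A))
      = (\<Sum>A | Z \<subseteq> A \<and> A \<subseteq> E. if A = E then int (r E) else 0)
        - (\<Sum>A | Z \<subseteq> A \<and> A \<subseteq> E. \<Sum>X\<in>Pow (E - A). (- 1) ^ card X * int (r (X \<union> A)))"
    by (simp add: signed_beta_contract flip: sum_subtractf)
  then show ?thesis
    using fin assms moebius_upper_sets[OF finite_ground assms, of "\<lambda>X. int (r X)"]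
    by (simp add: sum.delta)
qed

subsection \<open>The greedy algorithm\<close>

lemma basis_if_card_eq:
  assumes "indep E r B" "card B = r E"
  shows "basis E r B"
  unfolding basis_def
proof (intro conjI allI impI assms(1))
  fix I assume I: "indep E r I \<and> B \<subseteq> I"
  then have "card I \<le> card B" "finite I"
    using assms rank_mono[of I E] finite_ground by (auto simp: indep_def intro: finite_subset)
  then show "I = B" using I card_seteq by blast
qed

text \<open>An element is kept when it raises the rank of the whole initial segment, instead of
  being tested for independence from the elements kept so far. This avoids a recursion.\<close>

definition greedy_basis :: "(nat \<Rightarrow> 'a) \<Rightarrow> nat \<Rightarrow> 'a set" where
  "greedy_basis e n = {e k | k. k < n \<and> r (e ` {..<k}) < r (e ` {..<Suc k})}"

text \<open>The kept elements of each segment are independent and span it. Both facts go through one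
  induction, because spanning is what lets a rank jump of the segment pass to the kept
  elements.\<close>

lemma greedy_basis_segment:
  assumes e: "bij_betw e {..<n} E" and "k \<le> n"
  shows "card (greedy_basis e n \<inter> e ` {..<k}) = r (e ` {..<k})
    \<and> r (greedy_basis e n \<inter> e ` {..<k}) = r (e ` {..<k})"
  using \<open>k \<le> n\<close>
proof (induction k)
  case 0
  then show ?case using rank_le_card[of "{}"] by simp
next
  case (Suc k)
  let ?B = "greedy_basis e n" and ?S = "\<lambda>k. e ` {..<k}"
  have inj: "inj_on e {..<n}" and E: "e ` {..<n} = E" using e by (auto simp: bij_betw_def)
  have sub: "?S j \<subseteq> E" if "j \<le> n" for j using that E by auto
  have S: "?S (Suc k) = insert (e k) (?S k)" by (simp add: lessThan_Suc)
  have ek: "e k \<notin> ?S k"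
    using inj Suc.prems by (force dest: inj_onD)
  have IH: "card (?B \<inter> ?S k) = r (?S k)" "r (?B \<inter> ?S k) = r (?S k)"
    using Suc by auto
  have mem: "e k \<in> ?B \<longleftrightarrow> r (?S k) < r (?S (Suc k))"
    using inj Suc.prems by (auto simp: greedy_basis_def inj_on_def)
  show ?case
  proof (cases "e k \<in> ?B")
    case False
    have "r (?S k) \<le> r (?S (Suc k))"
      using sub[OF Suc.prems] S by (intro rank_mono) auto
    then have "r (?S (Suc k)) = r (?S k)" using False mem by simp
    moreover have "?B \<inter> ?S (Suc k) = ?B \<inter> ?S k" using False S by auto
    ultimately show ?thesis using IH by simp
  next
    case True
    let ?Y = "insert (e k) (?B \<inter> ?S k)"
    have Y: "?B \<inter> ?S (Suc k) = ?Y" using True S by auto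
    have YE: "?Y \<subseteq> E" using sub[OF Suc.prems] S by auto
    have cY: "card ?Y = Suc (r (?S k))" using ek IH by simp
    \<comment> \<open>The union is the next segment, and the intersection has the rank of
      \<open>?S k\<close> by induction, so \<open>?Y\<close> has at least the rank of the next
      segment. As that rank exceeds \<open>r (?S k)\<close> and
      \<open>card ?Y = Suc (r (?S k))\<close>, all these numbers agree.\<close>
    have "r (?S k \<union> ?Y) + r (?S k \<inter> ?Y) \<le> r (?S k) + r ?Y"
      using YE sub Suc.prems by (intro rank_submodular) auto
    moreover have "?S k \<union> ?Y = ?S (Suc k)" "?S k \<inter> ?Y = ?B \<inter> ?S k" using S ek by auto
    ultimately have "r (?S (Suc k)) \<le> r ?Y" using IH by simp
    moreover have "r ?Y \<le> card ?Y" using YE by (rule rank_le_card)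
    moreover have "r (?S k) < r (?S (Suc k))" using True mem by simp
    ultimately show ?thesis using cY Y by simp
  qed
qed

lemma basis_greedy_basis:
  assumes "bij_betw e {..<n} E"
  shows "basis E r (greedy_basis e n)"
proof -
  have E: "e ` {..<n} = E" using assms by (auto simp: bij_betw_def)
  then have "greedy_basis e n \<subseteq> E" by (auto simp: greedy_basis_def)
  then show ?thesis
    using greedy_basis_segment[OF assms, of n] E
    by (intro basis_if_card_eq) (auto simp: indep_def Int_absorb2)
qed

text \<open>A greedy basis has size \<open>r E\<close>; augmenting a smaller basis from it would
  contradict maximality.\<close>

lemma card_basis:
  assumes "basis E r B"
  shows "card B = r E"
proof -
  obtain e where e: "bij_betw e {..<card E} E"
    using ex_bij_betw_nat_finite[OF finite_ground] by (auto simp: atLeast0LessThan)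
  define G where "G = greedy_basis e (card E)"
  have E: "e ` {..<card E} = E" using e by (auto simp: bij_betw_def)
  have G: "basis E r G" using basis_greedy_basis[OF e] by (simp add: G_def)
  then have "G \<subseteq> E" by (auto simp: basis_def indep_def)
  then have cG: "card G = r E"
    using greedy_basis_segment[OF e, of "card E"] E by (simp add: G_def Int_absorb2)
  have B: "indep E r B" using assms by (simp add: basis_def)
  then have "card B \<le> r E" using rank_mono[of B E] by (auto simp: indep_def)
  moreover have "\<not> card B < card G"
  proof
    assume "card B < card G"
    then obtain x where "x \<in> G - B" "indep E r (insert x B)"
      using indep_augment[OF B, of G] G by (auto simp: basis_def)
    then show False using assms by (auto simp: basis_def)
  qed
  ultimately show ?thesis using cG by simp
qed

end

section \<open>Summation along an enumeration of the ground set\<close>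

lemma sum_by_segments:
  fixes v :: "'a \<Rightarrow> real"
  assumes "bij_betw e {..<n} E" "B \<subseteq> E"
  shows "(\<Sum>i\<in>B. v i)
    = (\<Sum>k<n. v (e k) * (real (card (B \<inter> e ` {..<Suc k})) - real (card (B \<inter> e ` {..<k}))))"
proof -
  have inj: "inj_on e {..<n}" and E: "e ` {..<n} = E" using assms by (auto simp: bij_betw_def)
  have fin: "finite E" using E by auto
  have "(\<Sum>i\<in>B. v i) = (\<Sum>i\<in>E. if i \<in> B then v i else 0)"
    using fin assms(2) by (simp add: sum.inter_restrict[symmetric] Int_absorb1)
  also have "\<dots> = (\<Sum>k<n. if e k \<in> B then v (e k) else 0)"
    using inj by (simp add: sum.reindex flip: E)
  also have "\<dots> = (\<Sum>k<n. v (e k) * (real (card (B \<inter> e ` {..<Suc k})) - real (card (B \<inter> e ` {..<k}))))"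
  proof (intro sum.cong refl)
    fix k assume "k \<in> {..<n}"
    then have ek: "e k \<notin> e ` {..<k}" using inj by (force dest: inj_onD)
    \<comment> \<open>Only \<open>e k\<close> can be new, so the difference of cardinalities is the
      indicator of \<open>e k\<close> being in \<open>B\<close>.\<close>
    have "B \<inter> e ` {..<Suc k} = (if e k \<in> B then insert (e k) (B \<inter> e ` {..<k}) else B \<inter> e ` {..<k})"
      by (auto simp: lessThan_Suc)
    then show "(if e k \<in> B then v (e k) else 0)
      = v (e k) * (real (card (B \<inter> e ` {..<Suc k})) - real (card (B \<inter> e ` {..<k})))"
      using ek by simp
  qed
  finally show ?thesis .
qed

text \<open>Summation by parts: the boundary terms vanish, and what remains are the nonnegative
  drops of \<open>u\<close> times values of \<open>d\<close>. The sign of \<open>u\<close> is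
  therefore irrelevant.\<close>

lemma sum_decreasing_differences_nonneg:
  fixes u d :: "nat \<Rightarrow> real"
  assumes "\<And>i j. i \<le> j \<Longrightarrow> j < n \<Longrightarrow> u j \<le> u i"
    and "d 0 = 0" "d n = 0" "\<And>k. k \<le> n \<Longrightarrow> 0 \<le> d k"
  shows "0 \<le> (\<Sum>k<n. u k * (d (Suc k) - d k))"
proof (cases n)
  case (Suc m)
  \<comment> \<open>Partial sums are bounded below by their boundary term, which is zero at the last
    index because \<open>d n = 0\<close>.\<close>
  have "u j * d (Suc j) \<le> (\<Sum>k<Suc j. u k * (d (Suc k) - d k))" if "j < n" for j
    using that
  proof (induction j)
    case 0
    then show ?case using assms(2) by simp
  next
    case (Suc j)
    have "u (Suc j) * d (Suc j) \<le> u j * d (Suc j)"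
      using assms(1)[of j "Suc j"] assms(4)[of "Suc j"] Suc.prems by (intro mult_right_mono) auto
    then show ?case using Suc by (simp add: right_diff_distrib)
  qed
  from this[of m] show ?thesis using Suc assms(3) by simp
qed simp

lemma ex_decreasing_enumeration:
  fixes v :: "'a \<Rightarrow> real"
  assumes "finite E"
  shows "\<exists>e n. bij_betw e {..<n::nat} E \<and> (\<forall>i j. i \<le> j \<longrightarrow> j < n \<longrightarrow> v (e j) \<le> v (e i))"
proof -
  obtain ys where ys: "set ys = E" "distinct ys" using finite_distinct_list[OF assms] by blast
  define xs where "xs = sort_key (\<lambda>i. - v i) ys"
  have xs: "set xs = E" "distinct xs" "sorted (map (\<lambda>i. - v i) xs)"
    using ys by (auto simp: xs_def)
  show ?thesis
  proof (intro exI conjI allI impI)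
    show "bij_betw ((!) xs) {..<length xs} E" using xs by (intro bij_betw_nth) auto
    show "v (xs ! j) \<le> v (xs ! i)" if "i \<le> j" "j < length xs" for i j
      using sorted_nth_mono[OF xs(3), of i j] that by simp
  qed
qed

subsection \<open>Support values of the two sides\<close>

lemma inner_sum_axis:
  fixes w :: "real ^ 'e"
  shows "w \<bullet> (\<Sum>i\<in>B. axis i 1) = (\<Sum>i\<in>B. w $ i)"
  by (simp add: inner_sum_right inner_axis)

lemma support_value_matroid_polytope:
  fixes E :: "'e::finite set" and w :: "real ^ 'e"
  assumes "matroid E r" and e: "bij_betw e {..<n} E"
    and dec: "\<And>i j. i \<le> j \<Longrightarrow> j < n \<Longrightarrow> w $ e j \<le> w $ e i"
  shows "support_value w (matroid_polytope E r)
    (\<Sum>k<n. w $ e k * (real (r (e ` {..<Suc k})) - real (r (e ` {..<k}))))"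
proof -
  interpret matroid E r by fact
  let ?S = "\<lambda>k. e ` {..<k}"
  let ?h = "\<Sum>k<n. w $ e k * (real (r (?S (Suc k))) - real (r (?S k)))"
  have E: "?S n = E" using e by (auto simp: bij_betw_def)
  have sub: "?S k \<subseteq> E" if "k \<le> n" for k using that E by auto
  have upper: "(\<Sum>i\<in>B. w $ i) \<le> ?h" if "basis E r B" for B
  proof -
    have B: "indep E r B" "B \<subseteq> E" "card B = r E"
      using that card_basis[OF that] by (simp_all add: basis_def indep_def)
    \<comment> \<open>The slack of \<open>B\<close> in each segment. It is nonnegative since
      \<open>B\<close> meets the segment in an independent set, and zero at \<open>n\<close> since
      all bases have size \<open>r E\<close>.\<close>
    define d where "d k = real (r (?S k)) - real (card (B \<inter> ?S k))" for k
    have "0 \<le> (\<Sum>k<n. w $ e k * (d (Suc k) - d k))"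
    proof (rule sum_decreasing_differences_nonneg[OF dec])
      show "d 0 = 0" using rank_le_card[of "{}"] by (simp add: d_def)
      show "d n = 0" using B E by (simp add: d_def Int_absorb2)
      fix k assume "k \<le> n"
      have "indep E r (B \<inter> ?S k)" using indep_subset[OF B(1)] by simp
      then show "0 \<le> d k"
        using rank_mono[OF Int_lower2 sub[OF \<open>k \<le> n\<close>], of B] by (simp add: d_def indep_def)
    qed
    also have "\<dots> = ?h - (\<Sum>i\<in>B. w $ i)"
      unfolding sum_by_segments[OF e B(2)] sum_subtractf[symmetric]
      by (intro sum.cong) (auto simp: d_def algebra_simps)
    finally show ?thesis by simp
  qed
  have G: "basis E r (greedy_basis e n)" using basis_greedy_basis[OF e] .
  then have "greedy_basis e n \<subseteq> E" by (auto simp: basis_def indep_def)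
  \<comment> \<open>For the greedy basis the slack is zero in every segment, so the bound is
    attained.\<close>
  then have "(\<Sum>i\<in>greedy_basis e n. w $ i) = ?h"
    using greedy_basis_segment[OF e] by (simp add: sum_by_segments[OF e] cong: sum.cong_simp)
  then show ?thesis
    unfolding matroid_polytope_def using upper G
    by (intro support_value_convex_hull) (auto simp: support_value_def inner_sum_axis)
qed

lemma support_value_coord_simplex:
  fixes w :: "real ^ 'e::finite"
  assumes "J \<noteq> {}"
  shows "support_value w (coord_simplex J) (Max (($) w ` J))"
proof -
  have "Max (($) w ` J) \<in> ($) w ` J" using assms by (intro Max_in) auto
  moreover have "w $ i \<le> Max (($) w ` J)" if "i \<in> J" for i using that by simp
  ultimately have "support_value w {axis i 1 | i. i \<in> J} (Max (($) w ` J))"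
    unfolding support_value_def by (fastforce simp: inner_axis simp del: Max_ge_iff)
  then show ?thesis
    unfolding coord_simplex_def by (rule support_value_convex_hull)
qed

text \<open>The growing segments leave \<open>A\<close> exactly once, on adding its first missing
  element, which has the largest weight outside \<open>A\<close>. In this form \<open>A\<close>
  enters only through indicators of upper sets.\<close>

lemma Max_by_segments:
  fixes v :: "'a \<Rightarrow> real"
  assumes e: "bij_betw e {..<n} E" and dec: "\<And>i j. i \<le> j \<Longrightarrow> j < n \<Longrightarrow> v (e j) \<le> v (e i)"
    and A: "A \<subset> E"
  shows "Max (v ` (E - A))
    = (\<Sum>k<n. v (e k) * (of_bool (e ` {..<k} \<subseteq> A) - of_bool (e ` {..<Suc k} \<subseteq> A)))"
proof -
  have E: "e ` {..<n} = E" using e by (auto simp: bij_betw_def)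
  define j where "j = (LEAST k. k < n \<and> e k \<notin> A)"
  have "\<exists>k. k < n \<and> e k \<notin> A" using A E by auto
  then have j: "j < n" "e j \<notin> A" unfolding j_def by (metis (mono_tags, lifting) LeastI_ex)+
  have least: "j \<le> k" if "k < n" "e k \<notin> A" for k
    unfolding j_def using that by (intro Least_le) simp
  have seg: "e ` {..<k} \<subseteq> A \<longleftrightarrow> k \<le> j" if "k \<le> n" for k
  proof
    assume "e ` {..<k} \<subseteq> A"
    then show "k \<le> j" using j(2) by (meson image_subset_iff lessThan_iff not_le)
  next
    assume "k \<le> j"
    then show "e ` {..<k} \<subseteq> A" using least that
      by (meson dual_order.strict_trans1 image_subsetI lessThan_iff not_le)
  qed
  have "Max (v ` (E - A)) = v (e j)"
  proof (rule Max_eqI)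
    show "finite (v ` (E - A))" using E by auto
    show "v (e j) \<in> v ` (E - A)" using j E by auto
    fix y assume "y \<in> v ` (E - A)"
    then obtain k where "k < n" "e k \<notin> A" "y = v (e k)" using E by auto
    then show "y \<le> v (e j)" using least dec by simp
  qed
  moreover have "(\<Sum>k<n. v (e k) * (of_bool (e ` {..<k} \<subseteq> A) - of_bool (e ` {..<Suc k} \<subseteq> A)))
      = (\<Sum>k<n. if k = j then v (e k) else 0)"
  proof (intro sum.cong refl)
    fix k assume "k \<in> {..<n}"
    then show "v (e k) * (of_bool (e ` {..<k} \<subseteq> A) - of_bool (e ` {..<Suc k} \<subseteq> A))
      = (if k = j then v (e k) else 0)"
      using seg[of k] seg[of "Suc k"] by auto
  qed
  ultimately show ?thesis using j by (simp add: sum.delta)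
qed

text \<open>After the sums are exchanged, the coefficient of \<open>v (e k)\<close> is a difference
  of two upper-set sums of signed beta invariants, in which \<open>r E\<close> cancels.\<close>

lemma (in matroid) sum_signed_beta_Max:
  fixes v :: "'a \<Rightarrow> real"
  assumes e: "bij_betw e {..<n} E" and dec: "\<And>i j. i \<le> j \<Longrightarrow> j < n \<Longrightarrow> v (e j) \<le> v (e i)"
  shows "(\<Sum>A\<in>Pow E. real_of_int (signed_beta (E - A) (contract r A)) * Max (v ` (E - A)))
    = (\<Sum>k<n. v (e k) * (real (r (e ` {..<Suc k})) - real (r (e ` {..<k}))))"
proof -
  define c where "c A = real_of_int (signed_beta (E - A) (contract r A))" for A
  let ?S = "\<lambda>k. e ` {..<k}"
  have E: "?S n = E" using e by (auto simp: bij_betw_def)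
  have up: "(\<Sum>A\<in>Pow E. c A * of_bool (Z \<subseteq> A)) = real (r E) - real (r Z)" if "Z \<subseteq> E" for Z
  proof -
    have "(\<Sum>A\<in>Pow E. c A * of_bool (Z \<subseteq> A)) = (\<Sum>A | A \<in> Pow E \<and> Z \<subseteq> A. c A)"
      using finite_ground by (subst sum.inter_filter) (simp, intro sum.cong, auto)
    also have "{A. A \<in> Pow E \<and> Z \<subseteq> A} = {A. Z \<subseteq> A \<and> A \<subseteq> E}" by auto
    finally show ?thesis
      using arg_cong[OF sum_signed_beta_contract[OF that], of real_of_int] by (simp add: c_def)
  qed
  have "(\<Sum>A\<in>Pow E. c A * Max (v ` (E - A)))
      = (\<Sum>A\<in>Pow E. \<Sum>k<n. v (e k) * (c A * of_bool (?S k \<subseteq> A) - c A * of_bool (?S (Suc k) \<subseteq> A)))"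
  proof (intro sum.cong refl)
    fix A assume "A \<in> Pow E"
    show "c A * Max (v ` (E - A))
      = (\<Sum>k<n. v (e k) * (c A * of_bool (?S k \<subseteq> A) - c A * of_bool (?S (Suc k) \<subseteq> A)))"
    \<comment> \<open>The maximum over the empty set has no useful value here, but its coefficient
      is zero.\<close>
    proof (cases "A = E")
      case True
      then show ?thesis using signed_beta_contract_ground by (simp add: c_def)
    next
      case False
      then have "A \<subset> E" using \<open>A \<in> Pow E\<close> by auto
      then show ?thesis
        using Max_by_segments[of e n E v A] e dec by (simp add: sum_distrib_left algebra_simps)
    qed
  qed
  also have "\<dots> = (\<Sum>k<n. \<Sum>A\<in>Pow E. v (e k) * (c A * of_bool (?S k \<subseteq> A) - c A * of_bool (?S (Suc k) \<subseteq> A)))"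
    by (rule sum.swap)
  also have "\<dots> = (\<Sum>k<n. v (e k) * (real (r (?S (Suc k))) - real (r (?S k))))"
  proof (intro sum.cong refl)
    fix k assume "k \<in> {..<n}"
    then have "?S k \<subseteq> E" "?S (Suc k) \<subseteq> E" using E by auto
    then show "(\<Sum>A\<in>Pow E. v (e k) * (c A * of_bool (?S k \<subseteq> A) - c A * of_bool (?S (Suc k) \<subseteq> A)))
        = v (e k) * (real (r (?S (Suc k))) - real (r (?S k)))"
      unfolding sum_distrib_left[symmetric] sum_subtractf by (simp add: up)
  qed
  finally show ?thesis by (simp add: c_def)
qed

section \<open>The signed Minkowski decomposition\<close>

theorem theorem2p5:
  fixes E :: "'e::finite set" and r :: "'e set \<Rightarrow> nat"
  assumes "matroid E r"
  shows "matroid_polytope E r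
      + (\<Sum>A | A \<subseteq> E \<and> signed_beta (E - A) (contract r A) < 0.
           (*\<^sub>R) (- real_of_int (signed_beta (E - A) (contract r A))) ` coord_simplex (E - A))
    = (\<Sum>A | A \<subseteq> E \<and> signed_beta (E - A) (contract r A) > 0.
           (*\<^sub>R) (real_of_int (signed_beta (E - A) (contract r A))) ` coord_simplex (E - A))
    \<and> signed_beta (E - E) (contract r E) = 0"
proof -
  interpret matroid E r by fact
  define c where "c A = signed_beta (E - A) (contract r A)" for A
  define N where "N = {A. A \<subseteq> E \<and> c A < 0}"
  define P where "P = {A. A \<subseteq> E \<and> c A > 0}"
  have cE: "c E = 0" using signed_beta_contract_ground by (simp add: c_def)
  \<comment> \<open>The zero coefficient at \<open>A = E\<close> keeps empty simplices, which have
    no support value, out of both sums.\<close>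
  have ne: "E - A \<noteq> {}" if "A \<in> N \<union> P" for A
    using that cE by (auto simp: N_def P_def)
  have simplex: "compact ((*\<^sub>R) s ` coord_simplex J) \<and> convex ((*\<^sub>R) s ` coord_simplex J)"
    for s and J :: "'e set"
    by (auto simp: coord_simplex_def setcompr_eq_image
        intro!: compact_scaling finite_imp_compact_convex_hull convex_scaling)
  have poly: "compact (matroid_polytope E r) \<and> convex (matroid_polytope E r)"
    by (auto simp: matroid_polytope_def setcompr_eq_image intro!: finite_imp_compact_convex_hull)
  have cc: "compact (\<Sum>A\<in>I. (*\<^sub>R) (s A) ` coord_simplex (E - A))
      \<and> convex (\<Sum>A\<in>I. (*\<^sub>R) (s A) ` coord_simplex (E - A))" for I and s :: "'e set \<Rightarrow> real"
    using simplex by (intro compact_convex_set_sum) auto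
  have "matroid_polytope E r + (\<Sum>A\<in>N. (*\<^sub>R) (- real_of_int (c A)) ` coord_simplex (E - A))
      = (\<Sum>A\<in>P. (*\<^sub>R) (real_of_int (c A)) ` coord_simplex (E - A))" (is "?L = ?R")
  proof (rule eq_if_support_values_eq)
    show "convex ?L" "closed ?L" "convex ?R" "closed ?R"
      using poly cc[of "\<lambda>A. - real_of_int (c A)" N] cc[of "\<lambda>A. real_of_int (c A)" P]
      by (blast intro: compact_imp_closed compact_set_plus convex_set_plus)+
  next
    fix w :: "real ^ 'e"
    obtain e and n :: nat
      where e: "bij_betw e {..<n} E" "\<And>i j. i \<le> j \<Longrightarrow> j < n \<Longrightarrow> w $ e j \<le> w $ e i"
      using ex_decreasing_enumeration[OF finite_ground, of "($) w"] by blast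
    define h where "h = (\<Sum>k<n. w $ e k * (real (r (e ` {..<Suc k})) - real (r (e ` {..<k}))))"
    define m where "m A = Max (($) w ` (E - A))" for A
    have m: "support_value w (coord_simplex (E - A)) (m A)" if "A \<in> N \<union> P" for A
      using support_value_coord_simplex[OF ne[OF that]] by (simp add: m_def)
    have L: "support_value w ?L (h + (\<Sum>A\<in>N. - real_of_int (c A) * m A))"
      unfolding h_def using assms e m
      by (intro support_value_plus support_value_matroid_polytope support_value_sum
          support_value_scaleR) (auto simp: N_def)
    have R: "support_value w ?R (\<Sum>A\<in>P. real_of_int (c A) * m A)"
      using m by (intro support_value_sum support_value_scaleR) (auto simp: P_def)
    \<comment> \<open>The scalar form of the signed identity; splitting it by the sign of
      \<open>c A\<close> and moving the negative part across matches the support values of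
      \<open>?L\<close> and \<open>?R\<close>.\<close>
    have "h = (\<Sum>A\<in>Pow E. real_of_int (c A) * m A)"
      using sum_signed_beta_Max[of e n "($) w"] e by (simp add: h_def c_def m_def)
    also have "\<dots> = (\<Sum>A\<in>N \<union> P. real_of_int (c A) * m A)"
      by (intro sum.mono_neutral_right) (auto simp: N_def P_def)
    also have "\<dots> = (\<Sum>A\<in>N. real_of_int (c A) * m A) + (\<Sum>A\<in>P. real_of_int (c A) * m A)"
      by (intro sum.union_disjoint) (auto simp: N_def P_def)
    finally have "h + (\<Sum>A\<in>N. - real_of_int (c A) * m A) = (\<Sum>A\<in>P. real_of_int (c A) * m A)"
      by (simp add: sum_negf)
    then show "\<exists>h. support_value w ?L h \<and> support_value w ?R h" using L R by auto
  qed
  then show ?thesis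
    using cE by (simp add: c_def N_def P_def)
qed

end
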